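(* Let $N,B,W,T$ be positive integers with $N\le B$, $B+1\le W$ and $T\ge B$, and set $T_{\mathrm{eff}}=\min(T,W-1)$. Then there exists a streaming code of some rate $R$ with delay $T$ over the channel $\mathcal{C}(N,B,W)$ such that \[ \left(\frac{R}{1-R}\right)B+N> T_{\mathrm{eff}} . \]
   Context: Channel $\mathcal{C}(N,B,W)$: a packet erasure channel on a sequence of channel uses $i=0,1,2,\dots$ such that in every sliding window of $W$ consecutive channel uses, the set of erased positions is either a single burst of consecutive erasures of length at most $B$, or consists of at most $N$ erasures in arbitrary positions. Streaming code (equal source–channel rates): at each time $i\ge 0$ the encoder observes a source symbol $\mathbf{s}[i]\in\mathbb{F}_q^k$ and transmits $\mathbf{x}[i]=f_i(\mathbf{s}[0],\dots,\mathbf{s}[i])\in\mathbb{F}_q^n$ over some finite field $\mathbb{F}_q$; the channel output is $\mathbf{y}[i]=\mathbf{x}[i]$ or $\mathbf{y}[i]=\star$ (erasure). The code has delay $T$ over the channel if there are decoding functions with $\mathbf{s}[i]=g_i(\mathbf{y}[0],\dots,\mathbf{y}[i+T])$ for every $i\ge0$, every source sequence and every erasure pattern allowed by the channel. Its rate is $R=k/n$. *)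

theory Defs
  imports Complex_Main "HOL-Algebra.Ring"
begin

definition admissible_erasures :: "nat \<Rightarrow> nat \<Rightarrow> nat \<Rightarrow> nat set \<Rightarrow> bool" where
  "admissible_erasures N B W E \<longleftrightarrow>
     (\<forall>j. (\<exists>a l. l \<le> B \<and> E \<inter> {j..<j+W} = {a..<a+l}) \<or> card (E \<inter> {j..<j+W}) \<le> N)"

definition is_vec :: "nat ring \<Rightarrow> nat \<Rightarrow> nat list \<Rightarrow> bool" where
  "is_vec F m v \<longleftrightarrow> length v = m \<and> set v \<subseteq> carrier F"

definition valid_source :: "nat ring \<Rightarrow> nat \<Rightarrow> (nat \<Rightarrow> nat list) \<Rightarrow> bool" where
  "valid_source F k s \<longleftrightarrow> (\<forall>i. is_vec F k (s i))"

text \<open>Channel output up to (and including) time t: the symbol x[j] or an erasure (None);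
  positions after t are masked, so a function of this value is a function of y[0..t].\<close>
definition channel_prefix ::
  "(nat \<Rightarrow> (nat \<Rightarrow> nat list) \<Rightarrow> nat list) \<Rightarrow> (nat \<Rightarrow> nat list) \<Rightarrow> nat set \<Rightarrow> nat \<Rightarrow> nat \<Rightarrow> nat list option" where
  "channel_prefix enc s E t = (\<lambda>j. if j \<le> t \<and> j \<notin> E then Some (enc j s) else None)"

definition streaming_code ::
  "nat ring \<Rightarrow> nat \<Rightarrow> nat \<Rightarrow> (nat \<Rightarrow> (nat \<Rightarrow> nat list) \<Rightarrow> nat list)
    \<Rightarrow> (nat \<Rightarrow> (nat \<Rightarrow> nat list option) \<Rightarrow> nat list) \<Rightarrow> nat \<Rightarrow> nat \<Rightarrow> nat \<Rightarrow> nat \<Rightarrow> bool" where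
  "streaming_code F k n enc dec T N B W \<longleftrightarrow>
     field F \<and> finite (carrier F) \<and> 0 < k \<and> 0 < n \<and>
     (\<forall>i s s'. (\<forall>j\<le>i. s j = s' j) \<longrightarrow> enc i s = enc i s') \<and>
     (\<forall>i s. valid_source F k s \<longrightarrow> is_vec F n (enc i s)) \<and>
     (\<forall>s E i. valid_source F k s \<longrightarrow> admissible_erasures N B W E \<longrightarrow>
        dec i (channel_prefix enc s E (i + T)) = s i)"

end

theory Submission
  imports Defs "HOL-Computational_Algebra.Polynomial" "HOL-Number_Theory.Cong"
begin

text \<open>
  The code has two layers of diagonally interleaved Reed--Solomon codes over a prime field with more
  than \<open>T\<close> elements, where \<open>T\<close> is the effective delay and \<open>m = T + 1 - N\<close>. A source packet is an
  \<open>m \<times> T\<close> array; its first \<open>T - B\<close> columns form \<open>v\<close> and its last \<open>B\<close> columns form \<open>u\<close>. Each row of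
  \<open>v\<close> is protected by a \<open>[T, T - B]\<close> code, to whose last \<open>B\<close> coordinates \<open>u\<close> delayed by \<open>T\<close> is
  added, and each column of \<open>u\<close> by a \<open>[T + 1, m]\<close> code. Suppose the past is known. At most \<open>B\<close>
  erasures in the window of length \<open>T + 1\<close> leave enough coordinates of the first code to recover the
  current \<open>v\<close>, and at most \<open>N\<close> erasures leave enough of the second to recover the current \<open>u\<close>. If
  a burst starts at the current time, every codeword of the first code which meets time \<open>T\<close> of the
  window can be decoded from the coordinates before time \<open>T\<close>, and subtracting them at time \<open>T\<close>
  reveals \<open>u\<close>. The rate satisfies \<open>R / (1 - R) = m T / (B (T + 1))\<close>, and \<open>m T / (T + 1) > T - N\<close>.
\<close>

section \<open>Prime fields on natural numbers\<close>

definition residue_field :: "nat \<Rightarrow> nat ring" where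
  "residue_field p = \<lparr>carrier = {..<p}, monoid.mult = (\<lambda>x y. x * y mod p), one = 1,
     zero = 0, add = (\<lambda>x y. (x + y) mod p)\<rparr>"

lemma field_residue_field:
  assumes "prime p"
  shows "field (residue_field p)"
proof -
  have p: "1 < p"
    using assms by (rule prime_gt_1_nat)
  have cr: "cring (residue_field p)"
  proof (rule cringI)
    show "abelian_group (residue_field p)"
    proof (rule abelian_groupI)
      fix x assume "x \<in> carrier (residue_field p)"
      then have "x < p" by (simp add: residue_field_def)
      then show "\<exists>y\<in>carrier (residue_field p). y \<oplus>\<^bsub>residue_field p\<^esub> x = \<zero>\<^bsub>residue_field p\<^esub>"
        using p by (intro bexI[of _ "(p - x) mod p"]) (auto simp: residue_field_def mod_add_left_eq)
    qed (use p in \<open>auto simp: residue_field_def mod_simps ac_simps\<close>)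
    show "comm_monoid (residue_field p)"
      by (rule comm_monoidI) (use p in \<open>auto simp: residue_field_def mod_simps ac_simps\<close>)
  qed (use p in \<open>auto simp: residue_field_def mod_simps algebra_simps\<close>)
  show ?thesis
  proof (rule cring.cring_fieldI2[OF cr])
    fix a assume "a \<in> carrier (residue_field p)" "a \<noteq> \<zero>\<^bsub>residue_field p\<^esub>"
    then have "coprime a p"
      using assms by (metis residue_field_def coprime_commute lessThan_iff linorder_not_less
          dvd_imp_le neq0_conv partial_object.simps(1) prime_imp_coprime ring.simps(1))
    then obtain b where "[a * b = Suc 0] (mod p)"
      using cong_solve_coprime_nat by blast
    then show "\<exists>b\<in>carrier (residue_field p). a \<otimes>\<^bsub>residue_field p\<^esub> b = \<one>\<^bsub>residue_field p\<^esub>"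
      using p by (intro bexI[of _ "b mod p"]) (auto simp: residue_field_def cong_def mod_simps)
  qed (auto simp: residue_field_def)
qed

section \<open>Reed--Solomon codes in the Newton basis, modulo \<open>p\<close>\<close>

definition falling :: "nat \<Rightarrow> nat \<Rightarrow> int" where
  "falling i j = (\<Prod>l<i. int j - int l)"

lemma falling_eq_0: "j < i \<Longrightarrow> falling i j = 0"
  by (auto simp: falling_def)

text \<open>\<open>falling j j\<close> is j!, the diagonal entry of a triangular system that has to
  be invertible modulo \<open>p\<close>.\<close>

lemma not_dvd_falling_self:
  assumes "prime p" "j < p"
  shows "\<not> int p dvd falling j j"
proof
  assume "int p dvd falling j j"
  then obtain l where "l < j" "int p dvd int j - int l"
    using assms(1) by (auto simp: falling_def prime_dvd_prod_iff)
  then show False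
    using assms(2) zdvd_imp_le[of "int p" "int j - int l"] by auto
qed

text \<open>Root counting over the residue field, phrased by divisibility: a root \<open>a\<close>
  is split off by synthetic division, and the quotient vanishes modulo \<open>p\<close> on the rest
  of \<open>S\<close>.\<close>

lemma prime_dvd_poly_of_many_roots:
  fixes g :: "int poly" and S :: "nat set"
  assumes "prime p" "S \<subseteq> {..<p}" "degree g < card S"
    and "\<And>x. x \<in> S \<Longrightarrow> int p dvd poly g (int x)"
  shows "int p dvd poly g y"
  using assms(2-)
proof (induction "degree g" arbitrary: g S y)
  case 0
  then obtain x where "x \<in> S"
    by fastforce
  then have "int p dvd poly g (int x)"
    using "0.prems"(3) by blast
  moreover obtain c where "g = [:c:]"
    using 0(1) by (metis degree_eq_zeroE)
  ultimately show ?case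
    by simp
next
  case (Suc d)
  have fin: "finite S"
    using Suc.prems(1) finite_subset by blast
  obtain a where a: "a \<in> S"
    using Suc.prems(2) by fastforce
  define q where "q = synthetic_div g (int a)"
  have g: "poly g z = (z - int a) * poly q z + poly g (int a)" for z
    using arg_cong[OF synthetic_div_correct'[of "int a" g], of "\<lambda>f. poly f z"]
    by (simp add: q_def algebra_simps)
  have "int p dvd poly q y"
  proof (rule Suc.hyps(1))
    show d: "d = degree q"
      by (simp add: q_def degree_synthetic_div flip: Suc.hyps(2))
    show "degree q < card (S - {a})"
      using a fin Suc.prems(2) by (simp flip: d Suc.hyps(2))
    show "S - {a} \<subseteq> {..<p}"
      using Suc.prems(1) by blast
    fix x assume x: "x \<in> S - {a}"
    have "int p dvd (int x - int a) * poly q (int x)"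
      using Suc.prems(3)[of x] Suc.prems(3)[OF a] x
      by (simp add: g[of "int x"] dvd_add_left_iff)
    moreover have "\<not> int p dvd int x - int a"
    proof -
      have "x < p" "a < p" "x \<noteq> a"
        using x a Suc.prems(1) by auto
      then show ?thesis
        using zdvd_imp_le[of "int p" "int x - int a"] zdvd_imp_le[of "int p" "int a - int x"]
        by (cases "x < a") (auto simp: dvd_diff_commute)
    qed
    ultimately show "int p dvd poly q (int x)"
      using assms(1) by (meson prime_dvd_mult_iff prime_nat_int_transfer)
  qed
  then show ?case
    using Suc.prems(3)[OF a] by (simp add: g[of y])
qed

text \<open>
  Reed--Solomon evaluation at \<open>j\<close> of a polynomial given in the Newton basis. Since
  \<open>falling i j = 0\<close> for \<open>j < i\<close>, coordinate \<open>j\<close> depends only on the message symbols up to \<open>j\<close>, which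
  makes diagonal interleaving causal without a systematic encoder.
\<close>
definition codeword :: "nat \<Rightarrow> (nat \<Rightarrow> int) \<Rightarrow> nat \<Rightarrow> int" where
  "codeword K m j = (\<Sum>i<K. m i * falling i j)"

lemma codeword_eq_sum_poly:
  "codeword K m j = poly (\<Sum>i<K. smult (m i) (\<Prod>l<i. [:- int l, 1:])) (int j)"
  by (simp add: codeword_def falling_def poly_sum poly_prod)

lemma codeword_diff: "codeword K (\<lambda>i. m i - m' i) j = codeword K m j - codeword K m' j"
  by (simp add: codeword_def left_diff_distrib sum_subtractf)

lemma codeword_cong:
  assumes "\<And>i. i \<le> j \<Longrightarrow> m i = m' i"
  shows "codeword K m j = codeword K m' j"
  unfolding codeword_def
proof (rule sum.cong)
  fix i
  show "m i * falling i j = m' i * falling i j"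
    using assms[of i] by (cases "i \<le> j") (auto simp: falling_eq_0)
qed simp

lemma dvd_codeword:
  assumes "\<And>i. i < K \<Longrightarrow> i \<le> j \<Longrightarrow> d dvd m i"
  shows "d dvd codeword K m j"
  unfolding codeword_def
proof (rule dvd_sum)
  fix i assume "i \<in> {..<K}"
  then show "d dvd m i * falling i j"
    using assms[of i] by (cases "i \<le> j") (auto simp: falling_eq_0)
qed

text \<open>Forward substitution. Here and below \<open>m\<close> plays the difference of two
  messages, so divisibility by \<open>p\<close> means that they agree.\<close>

lemma dvd_message_of_dvd_prefix:
  assumes "prime p" "i < p" "i < K" "\<And>j. j \<le> i \<Longrightarrow> int p dvd codeword K m j"
  shows "int p dvd m i"
  using assms(2-)
proof (induction i rule: less_induct)
  case (less i)
  have prev: "int p dvd m l" if "l < i" for l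
    by (rule less.IH) (use that less.prems in auto)
  have "codeword K m i = m i * falling i i + (\<Sum>l\<in>{..<K} - {i}. m l * falling l i)"
    unfolding codeword_def using less.prems by (subst sum.remove[of _ i]) auto
  moreover have "int p dvd (\<Sum>l\<in>{..<K} - {i}. m l * falling l i)"
  proof (rule dvd_sum)
    fix l assume "l \<in> {..<K} - {i}"
    then show "int p dvd m l * falling l i"
      using prev[of l] by (cases "l < i") (auto simp: falling_eq_0)
  qed
  ultimately have "int p dvd m i * falling i i"
    using less.prems(3)[of i] by (simp add: dvd_add_left_iff)
  then show ?case
    using not_dvd_falling_self[OF assms(1) less.prems(1)] assms(1)
    by (meson prime_dvd_mult_iff prime_nat_int_transfer)
qed

text \<open>The MDS property: vanishing on \<open>K\<close> points forces vanishing everywhere, in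
  particular on the prefix 0, ..., \<open>i\<close>, where forward substitution applies.\<close>

lemma dvd_message_of_dvd_codeword:
  assumes "prime p" "S \<subseteq> {..<p}" "K \<le> card S" "i < K"
    and "\<And>j. j \<in> S \<Longrightarrow> int p dvd codeword K m j"
  shows "int p dvd m i"
proof -
  define g where "g = (\<Sum>i<K. smult (m i) (\<Prod>l<i. [:- int l, 1:]))"
  have "degree g \<le> K - 1"
    unfolding g_def
  proof (rule degree_sum_le)
    fix i assume i: "i \<in> {..<K}"
    have "degree (smult (m i) (\<Prod>l<i. [:- int l, 1:])) \<le> degree (\<Prod>l<i. [:- int l, 1:])"
      by (rule degree_smult_le)
    also have "\<dots> \<le> (\<Sum>l<i. degree [:- int l, 1:])"
      using degree_prod_sum_le[of "{..<i}" "\<lambda>l. [:- int l, 1:]"] by (simp add: o_def)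
    also have "\<dots> \<le> K - 1"
      using i by simp
    finally show "degree (smult (m i) (\<Prod>l<i. [:- int l, 1:])) \<le> K - 1" .
  qed simp
  then have deg: "degree g < card S"
    using assms(3,4) by linarith
  have "int p dvd poly g (int j)" for j
  proof (rule prime_dvd_poly_of_many_roots[OF assms(1,2) deg])
    fix x assume "x \<in> S"
    then show "int p dvd poly g (int x)"
      using assms(5)[of x] by (simp only: g_def codeword_eq_sum_poly)
  qed
  then have "int p dvd codeword K m j" for j
    by (simp only: g_def codeword_eq_sum_poly)
  moreover have "i < p"
    using card_mono[OF finite_lessThan assms(2)] assms(3,4) by simp
  ultimately show ?thesis
    using assms(4) by (simp add: dvd_message_of_dvd_prefix[OF assms(1)])
qed

text \<open>Symbol \<open>i\<close> belongs to the current time and \<open>X\<close> holds the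
  erased time offsets. Coordinates before \<open>i\<close> involve past symbols only, so they count
  as received.\<close>

lemma dvd_message_of_few_erasures:
  assumes "prime p" "L \<le> p" "finite X" "K + card X \<le> L" "i < K"
    and past: "\<And>l. l < i \<Longrightarrow> int p dvd m l"
    and received: "\<And>j. i \<le> j \<Longrightarrow> j < L \<Longrightarrow> j - i \<notin> X \<Longrightarrow> int p dvd codeword K m j"
  shows "int p dvd m i"
proof -
  define S where "S = {..<L} - (\<lambda>d. d + i) ` X"
  have "K \<le> card S"
    using card_image_le[OF assms(3), of "\<lambda>d. d + i"] assms(4)
      diff_card_le_card_Diff[of "(\<lambda>d. d + i) ` X" "{..<L}"] assms(3)
    by (simp add: S_def)
  show ?thesis
  proof (rule dvd_message_of_dvd_codeword[OF assms(1) _ \<open>K \<le> card S\<close> assms(5)])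
    show "S \<subseteq> {..<p}"
      using assms(2) by (auto simp: S_def)
    fix j assume j: "j \<in> S"
    show "int p dvd codeword K m j"
    proof (cases "i \<le> j")
      case True
      then have "j - i \<notin> X"
        using j by (force simp: S_def)
      then show ?thesis
        using received[OF True] j by (simp add: S_def)
    next
      case False
      then show ?thesis
        by (intro dvd_codeword past) simp
    qed
  qed
qed

section \<open>The two layers and recovery of the current packet\<close>

locale layered_code =
  fixes N B T p :: nat
  assumes prime_p: "prime p" and T_less_p: "T < p"
    and N_pos: "0 < N" and N_le_B: "N \<le> B" and B_le_T: "B \<le> T"
begin

definition m :: nat where
  "m = T + 1 - N"

lemma m_pos: "0 < m" and m_le: "m \<le> T" and m_plus_N: "m + N = T + 1"
  using N_pos N_le_B B_le_T by (auto simp: m_def)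

text \<open>
  Entry \<open>(r, c)\<close> of the source array is component \<open>r * T + c\<close>. Coordinate \<open>j\<close> sent at time \<open>t\<close> belongs
  to the diagonal codeword that starts at time \<open>t - j\<close>, which may be negative.
\<close>
definition burst_layer :: "(int \<Rightarrow> nat \<Rightarrow> int) \<Rightarrow> int \<Rightarrow> nat \<Rightarrow> nat \<Rightarrow> int" where
  "burst_layer D t r j = codeword (T - B) (\<lambda>i. D (t - int j + int i) (r * T + i)) j
     + (if j < T - B then 0 else D (t - int T) (r * T + j))"

definition random_layer :: "(int \<Rightarrow> nat \<Rightarrow> int) \<Rightarrow> int \<Rightarrow> nat \<Rightarrow> nat \<Rightarrow> int" where
  "random_layer D t c j = codeword m (\<lambda>r. D (t - int j + int r) (r * T + c)) j"

text \<open>Linearity reduces unique decoding to the difference \<open>D\<close> of two source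
  streams.\<close>

lemma layer_diff:
  "burst_layer (\<lambda>\<tau> c. D \<tau> c - D' \<tau> c) t r j = burst_layer D t r j - burst_layer D' t r j"
  "random_layer (\<lambda>\<tau> c. D \<tau> c - D' \<tau> c) t r j = random_layer D t r j - random_layer D' t r j"
  by (simp_all add: burst_layer_def random_layer_def codeword_diff)

lemma layer_causal:
  assumes "\<And>\<tau>. \<tau> \<le> t \<Longrightarrow> D \<tau> = D' \<tau>"
  shows "burst_layer D t r j = burst_layer D' t r j"
    and "random_layer D t r j = random_layer D' t r j"
  unfolding burst_layer_def random_layer_def
  by (auto simp: assms intro!: codeword_cong arg_cong2[where f = "(+)"])

text \<open>Before time \<open>t0\<close> + \<open>T\<close> the added entry comes from before
  \<open>t0\<close>, so it can be stripped off.\<close>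

lemma dvd_burst_codeword:
  assumes "\<And>\<tau> c. \<tau> < t0 \<Longrightarrow> int p dvd D \<tau> c" "t - int T < t0"
    and "int p dvd burst_layer D t r j" "t1 = t - int j"
  shows "int p dvd codeword (T - B) (\<lambda>i. D (t1 + int i) (r * T + i)) j"
proof -
  have "int p dvd (if j < T - B then 0 else D (t - int T) (r * T + j))"
    using assms(1)[OF assms(2)] by simp
  then show ?thesis
    using assms(3) unfolding burst_layer_def assms(4) by (simp only: dvd_add_left_iff)
qed

lemma dvd_source_of_received:
  fixes X :: "nat set"
  assumes "finite X" and X: "card X \<le> N \<or> card X \<le> B \<and> (0 \<in> X \<longrightarrow> X \<subseteq> {..<B})"
    and past: "\<And>\<tau> c. \<tau> < t \<Longrightarrow> int p dvd D \<tau> c"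
    and burst: "\<And>d r j. d \<le> T \<Longrightarrow> d \<notin> X \<Longrightarrow> r < m \<Longrightarrow> j < T \<Longrightarrow>
      int p dvd burst_layer D (t + int d) r j"
    and random: "\<And>d c j. d \<le> T \<Longrightarrow> d \<notin> X \<Longrightarrow> T - B \<le> c \<Longrightarrow> c < T \<Longrightarrow> j \<le> T \<Longrightarrow>
      int p dvd random_layer D (t + int d) c j"
    and "r < m" "c < T"
  shows "int p dvd D t (r * T + c)"
proof -
  \<comment> \<open>A burst that does not start now leaves the current packet intact, which gives
    \<open>u_received\<close>.\<close>
  consider (v) "c < T - B" | (u_random) "T - B \<le> c" "card X \<le> N"
    | (u_received) "T - B \<le> c" "0 \<notin> X"
    | (u_burst) "T - B \<le> c" "X \<subseteq> {..<B}"
    using X by fastforce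
  then show ?thesis
  proof cases
    case v
    \<comment> \<open>This diagonal carries entry (\<open>r\<close>, \<open>c\<close>) at time
      \<open>t\<close>; its last coordinate is sent before \<open>t\<close> + \<open>T\<close>, so
      all entries added to it from time \<open>t\<close> on are past ones.\<close>
    let ?M = "\<lambda>i. D (t - int c + int i) (r * T + i)"
    have "int p dvd ?M c"
    proof (rule dvd_message_of_few_erasures[where m = ?M, OF prime_p _ assms(1) _ v, where L = T])
      show "T - B + card X \<le> T"
        using X N_le_B B_le_T by auto
      fix j assume j: "c \<le> j" "j < T" "j - c \<notin> X"
      show "int p dvd codeword (T - B) ?M j"
        using j burst[of "j - c" r j] \<open>r < m\<close>
        by (intro dvd_burst_codeword[where t = "t + int (j - c)", OF past]) auto
    qed (use T_less_p past in auto)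
    then show ?thesis
      by simp
  next
    case u_random
    let ?M = "\<lambda>i. D (t - int r + int i) (i * T + c)"
    have "int p dvd ?M r"
    proof (rule dvd_message_of_few_erasures[where m = ?M, OF prime_p _ assms(1) _ \<open>r < m\<close>, where L = "T + 1"])
      show "m + card X \<le> T + 1"
        using u_random m_plus_N by simp
      fix j assume "r \<le> j" "j < T + 1" "j - r \<notin> X"
      then show "int p dvd codeword m ?M j"
        using random[of "j - r" c j] u_random \<open>c < T\<close>
        by (simp add: random_layer_def of_nat_diff)
    qed (use T_less_p past in auto)
    then show ?thesis
      by simp
  next
    case u_received
    let ?M = "\<lambda>i. D (t - int r + int i) (i * T + c)"
    have "int p dvd ?M r"
    proof (rule dvd_message_of_dvd_prefix[where m = ?M, OF prime_p _ \<open>r < m\<close>])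
      show "r < p"
        using \<open>r < m\<close> m_le T_less_p by simp
      fix j assume "j \<le> r"
      show "int p dvd codeword m ?M j"
      proof (cases "j = r")
        case True
        then show ?thesis
          using random[of 0 c r] u_received \<open>r < m\<close> m_le \<open>c < T\<close>
          by (simp add: random_layer_def)
      next
        case False
        then show ?thesis
          using \<open>j \<le> r\<close> by (intro dvd_codeword past) simp
      qed
    qed
    then show ?thesis
      by simp
  next
    case u_burst
    \<comment> \<open>The diagonal starting at \<open>t\<close> + \<open>g\<close> has its
      coordinate \<open>c\<close> at time \<open>t\<close> + \<open>T\<close>, where the wanted
      entry of time \<open>t\<close> is added.\<close>
    define g where "g = T - c"
    have g: "0 < g" "g \<le> B" "T = c + g"
      using u_burst(1) \<open>c < T\<close> by (auto simp: g_def)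
    let ?M = "\<lambda>i. D (t + int g + int i) (r * T + i)"
    have "int p dvd ?M i" if "i < T - B" for i
    \<comment> \<open>These \<open>T - B\<close> coordinates are sent at times \<open>t\<close> +
      \<open>B\<close> to \<open>t\<close> + \<open>T\<close> - 1, after the burst.\<close>
    proof (rule dvd_message_of_dvd_codeword[where m = ?M and S = "{B - g..<T - g}", OF prime_p _ _ that])
      fix j assume "j \<in> {B - g..<T - g}"
      then have j: "B \<le> g + j" "g + j < T"
        by auto
      moreover have "int p dvd burst_layer D (t + int (g + j)) r j"
        using j u_burst(2) \<open>r < m\<close> by (intro burst) auto
      ultimately show "int p dvd codeword (T - B) ?M j"
        by (intro dvd_burst_codeword[where t = "t + int (g + j)", OF past]) auto
    qed (use g B_le_T T_less_p in auto)
    then have "int p dvd codeword (T - B) ?M c"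
      by (rule dvd_codeword)
    moreover have "int p dvd burst_layer D (t + int T) r c"
      using u_burst(2) B_le_T \<open>r < m\<close> \<open>c < T\<close> by (intro burst) auto
    then have "int p dvd codeword (T - B) ?M c + D t (r * T + c)"
      using u_burst(1) \<open>c < T\<close> by (simp add: burst_layer_def g_def of_nat_diff add_diff_eq)
    ultimately show ?thesis
      by (simp add: dvd_add_right_iff)
  qed
qed

section \<open>Encoder, channel windows and decoder\<close>

text \<open>Zero padding at negative times completes the diagonals that start before time 0.\<close>

definition source_stream :: "(nat \<Rightarrow> nat list) \<Rightarrow> int \<Rightarrow> nat \<Rightarrow> int" where
  "source_stream s \<tau> c = (if \<tau> < 0 then 0 else int (s (nat \<tau>) ! c))"

definition encode :: "nat \<Rightarrow> (nat \<Rightarrow> nat list) \<Rightarrow> nat list" where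
  "encode t s =
     map (\<lambda>l. nat (burst_layer (source_stream s) (int t) (l div T) (l mod T) mod int p)) [0..<m * T] @
     map (\<lambda>l. nat (random_layer (source_stream s) (int t) (T - B + l div (T + 1)) (l mod (T + 1))
       mod int p)) [0..<B * (T + 1)]"

lemma encode_causal:
  assumes "\<forall>j\<le>t. s j = s' j"
  shows "encode t s = encode t s'"
proof -
  have "source_stream s \<tau> = source_stream s' \<tau>" if "\<tau> \<le> int t" for \<tau>
    using assms that by (auto simp: source_stream_def)
  then show ?thesis
    unfolding encode_def by (simp add: layer_causal[of "int t" "source_stream s" "source_stream s'"])
qed

lemma is_vec_encode: "is_vec (residue_field p) (m * T + B * (T + 1)) (encode t s)"
  using prime_gt_0_nat[OF prime_p]
  by (auto simp: is_vec_def encode_def residue_field_def nat_less_iff)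

lemma dvd_layers_of_encode_eq:
  assumes "encode t s = encode t s'"
  shows "r < m \<Longrightarrow> j < T \<Longrightarrow> int p dvd
      burst_layer (\<lambda>\<tau> c. source_stream s \<tau> c - source_stream s' \<tau> c) (int t) r j"
    and "T - B \<le> c \<Longrightarrow> c < T \<Longrightarrow> j \<le> T \<Longrightarrow> int p dvd
      random_layer (\<lambda>\<tau> c. source_stream s \<tau> c - source_stream s' \<tau> c) (int t) c j"
proof -
  have p: "0 < int p"
    using prime_gt_0_nat[OF prime_p] by simp
  have dvd: "int p dvd x - y" if "nat (x mod int p) = nat (y mod int p)" for x y
    using that p by (simp add: eq_nat_nat_iff mod_eq_dvd_iff)
  have eq: "\<And>l. l < m * T \<Longrightarrow>
      nat (burst_layer (source_stream s) (int t) (l div T) (l mod T) mod int p) =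
      nat (burst_layer (source_stream s') (int t) (l div T) (l mod T) mod int p)"
    "\<And>l. l < B * (T + 1) \<Longrightarrow>
      nat (random_layer (source_stream s) (int t) (T - B + l div (T + 1)) (l mod (T + 1)) mod int p) =
      nat (random_layer (source_stream s') (int t) (T - B + l div (T + 1)) (l mod (T + 1)) mod int p)"
    using assms unfolding encode_def by (simp_all add: map_eq_conv)
  have idx: "a * d + b < e * d" if "a < e" "b < d" for a b d e :: nat
  proof -
    have "a * d + b < Suc a * d"
      using that by simp
    also have "\<dots> \<le> e * d"
      using that by (intro mult_right_mono) auto
    finally show ?thesis .
  qed
  show "int p dvd burst_layer (\<lambda>\<tau> c. source_stream s \<tau> c - source_stream s' \<tau> c) (int t) r j"
    if "r < m" "j < T"
    using eq(1)[OF idx[OF that]] that by (simp add: layer_diff dvd)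
  show "int p dvd random_layer (\<lambda>\<tau> c. source_stream s \<tau> c - source_stream s' \<tau> c) (int t) c j"
    if "T - B \<le> c" "c < T" "j \<le> T"
  proof -
    have c: "c - (T - B) < B" "j < T + 1"
      using that B_le_T by auto
    then have "((c - (T - B)) * (T + 1) + j) div (T + 1) = c - (T - B)"
      "((c - (T - B)) * (T + 1) + j) mod (T + 1) = j"
      by (simp_all only: div_mult_self3 mod_mult_self3 div_less mod_less)
    then show ?thesis
      using eq(2)[OF idx[OF c]] that(1) by (simp add: layer_diff dvd del: mult_Suc_right)
  qed
qed

text \<open>As \<open>T < W\<close>, the decoding window lies in one channel window. A burst of
  length at most \<open>B\<close> covering offset 0 ends before offset \<open>B\<close>.\<close>

lemma erasures_in_window:
  fixes t :: nat
  assumes "admissible_erasures N B W E" "T < W"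
  defines "X \<equiv> {d. d \<le> T \<and> t + d \<in> E}"
  shows "card X \<le> N \<or> card X \<le> B \<and> (0 \<in> X \<longrightarrow> X \<subseteq> {..<B})"
proof -
  have X: "(\<lambda>d. t + d) ` X \<subseteq> E \<inter> {t..<t + W}"
    using assms(2) by (auto simp: X_def)
  have card: "card X \<le> card (E \<inter> {t..<t + W})"
    using card_mono[OF _ X] by (simp add: card_image)
  have "(\<exists>a l. l \<le> B \<and> E \<inter> {t..<t + W} = {a..<a + l}) \<or> card (E \<inter> {t..<t + W}) \<le> N"
    using assms(1) by (simp add: admissible_erasures_def)
  then show ?thesis
  proof (elim disjE exE conjE)
    fix a l assume l: "l \<le> B" "E \<inter> {t..<t + W} = {a..<a + l}"
    have "d < B" if "0 \<in> X" "d \<in> X" for d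
    proof -
      have "t + 0 \<in> {a..<a + l}" "t + d \<in> {a..<a + l}"
        using that X l(2) by blast+
      then show ?thesis
        using l(1) by simp
    qed
    then show ?thesis
      using card l by auto
  qed (use card in simp)
qed

text \<open>Induction over time supplies the known past; recovering packet \<open>i\<close> uses
  nothing after time \<open>i + T\<close>.\<close>

lemma source_eq_of_received_eq:
  assumes "valid_source (residue_field p) (m * T) s" "valid_source (residue_field p) (m * T) s'"
    and "admissible_erasures N B W E" "T < W"
    and "\<And>t. t \<le> i + T \<Longrightarrow> t \<notin> E \<Longrightarrow> encode t s = encode t s'"
  shows "s i = s' i"
  using assms(5)
proof (induction i rule: less_induct)
  case (less i)
  let ?D = "\<lambda>\<tau> c. source_stream s \<tau> c - source_stream s' \<tau> c"
  have prev: "s j = s' j" if "j < i" for j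
    by (rule less.IH) (use that less.prems in auto)
  have past: "int p dvd ?D \<tau> c" if "\<tau> < int i" for \<tau> c
    using prev[of "nat \<tau>"] that by (auto simp: source_stream_def)
  have dvd: "int p dvd ?D (int i) (r * T + c)" if "r < m" "c < T" for r c
  proof (rule dvd_source_of_received[OF _ erasures_in_window[OF assms(3,4), of i] past])
    fix d assume d: "d \<le> T" "d \<notin> {d. d \<le> T \<and> i + d \<in> E}"
    then have eq: "encode (i + d) s = encode (i + d) s'"
      using less.prems by simp
    show "int p dvd burst_layer ?D (int i + int d) r j" if "r < m" "j < T" for r j
      using dvd_layers_of_encode_eq(1)[OF eq that] by simp
    show "int p dvd random_layer ?D (int i + int d) c j" if "T - B \<le> c" "c < T" "j \<le> T" for c j
      using dvd_layers_of_encode_eq(2)[OF eq that] by simp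
  qed (use that in auto)
  have vec: "is_vec (residue_field p) (m * T) (s i)" "is_vec (residue_field p) (m * T) (s' i)"
    using assms(1,2) by (auto simp: valid_source_def)
  show ?case
  proof (rule nth_equalityI)
    show "length (s i) = length (s' i)"
      using vec by (simp add: is_vec_def)
    fix l assume l: "l < length (s i)"
    then have "l < m * T"
      using vec(1) by (simp add: is_vec_def)
    then have "l div T < m" "l mod T < T"
      using m_pos m_le by (simp_all add: less_mult_imp_div_less)
    \<comment> \<open>Congruent symbols coincide, since both lie below \<open>p\<close>.\<close>
    then have "int p dvd int (s i ! l) - int (s' i ! l)"
      using dvd[of "l div T" "l mod T"] by (simp add: source_stream_def)
    moreover have "s i ! l \<in> {..<p}" "s' i ! l \<in> {..<p}"
      using vec l nth_mem[of l "s i"] nth_mem[of l "s' i"]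
      by (auto simp: is_vec_def residue_field_def simp del: nth_mem)
    ultimately show "s i ! l = s' i ! l"
      by (simp add: mod_eq_dvd_iff[symmetric])
  qed
qed

text \<open>The decoder picks any source that explains the received prefix under some admissible
  pattern; uniqueness makes its packet \<open>i\<close> the true one.\<close>

lemma streaming_code_encode:
  assumes "T < W" "T \<le> T'"
  shows "\<exists>dec. streaming_code (residue_field p) (m * T) (m * T + B * (T + 1)) encode dec T' N B W"
proof -
  let ?F = "residue_field p"
  define consistent where "consistent i y s \<longleftrightarrow> valid_source ?F (m * T) s \<and>
    (\<exists>E. admissible_erasures N B W E \<and> channel_prefix encode s E (i + T') = y)" for i y s
  have "(SOME s. consistent i (channel_prefix encode s0 E (i + T')) s) i = s0 i"
    if s0: "valid_source ?F (m * T) s0" and E: "admissible_erasures N B W E" for s0 E i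
  proof -
    let ?s = "SOME s. consistent i (channel_prefix encode s0 E (i + T')) s"
    have "consistent i (channel_prefix encode s0 E (i + T')) s0"
      using that by (auto simp: consistent_def)
    then have "consistent i (channel_prefix encode s0 E (i + T')) ?s"
      by (rule someI[where P = "consistent i (channel_prefix encode s0 E (i + T'))"])
    then obtain E' where valid: "valid_source ?F (m * T) ?s"
      and eq: "channel_prefix encode ?s E' (i + T') = channel_prefix encode s0 E (i + T')"
      by (auto simp: consistent_def)
    show ?thesis
    proof (rule source_eq_of_received_eq[OF valid s0 E assms(1)])
      \<comment> \<open>\<open>E'\<close> may differ from \<open>E\<close>, but an output
        \<open>Some\<close> at \<open>t\<close> rules out an erasure by \<open>E'\<close>
        there.\<close>
      fix t assume "t \<le> i + T" "t \<notin> E"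
      then show "encode t ?s = encode t s0"
        using fun_cong[OF eq, of t] assms(2) by (auto simp: channel_prefix_def split: if_splits)
    qed
  qed
  moreover have "field ?F" "finite (carrier ?F)"
    using field_residue_field[OF prime_p] by (auto simp: residue_field_def)
  moreover have "0 < m * T"
    using m_pos m_le by simp
  ultimately show ?thesis
    unfolding streaming_code_def using encode_causal is_vec_encode
    by (intro exI[of _ "\<lambda>i y. (SOME s. consistent i y s) i"]) auto
qed

section \<open>Rate and conclusion\<close>

lemma rate_bound:
  defines "R \<equiv> real (m * T) / real (m * T + B * (T + 1))"
  shows "R / (1 - R) * real B + real N > real T"
proof -
  have pos: "0 < real B" "0 < real (T + 1)"
    using N_pos N_le_B by auto
  have cancel: "x / (b * y) * b = x / y" if "0 < b" for x y b :: real
    using that by simp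
  have m: "real m = real T + 1 - real N"
    using m_plus_N by linarith
  have n: "real (m * T + B * (T + 1)) \<noteq> 0"
    using N_pos N_le_B by (simp only: of_nat_eq_0_iff) simp
  have "1 - R = (real (m * T + B * (T + 1)) - real (m * T)) / real (m * T + B * (T + 1))"
    unfolding R_def diff_divide_distrib divide_self[OF n] ..
  then have "R / (1 - R) = real (m * T) / real (B * (T + 1))"
    using n by (simp add: R_def)
  then have "R / (1 - R) * real B = real (m * T) / real (T + 1)"
    using pos(1) by (simp only: of_nat_mult cancel)
  \<comment> \<open>The two sides differ by exactly \<open>N\<close>.\<close>
  moreover have "real (m * T) > (real T - real N) * real (T + 1)"
    using N_pos by (simp add: m algebra_simps)
  then have "real (m * T) / real (T + 1) > real T - real N"
    using pos(2) by (simp add: pos_less_divide_eq)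
  ultimately show ?thesis
    by linarith
qed

end

theorem theorem2:
  fixes N B W T :: nat
  assumes "0 < N" "0 < B" "0 < W" "0 < T"
    and "N \<le> B" "B + 1 \<le> W" "T \<ge> B"
  shows "\<exists>(F :: nat ring) k n enc dec.
           streaming_code F k n enc dec T N B W \<and> k < n \<and>
           (let R = real k / real n
            in (R / (1 - R)) * real B + real N > real (min T (W - 1)))"
proof -
  \<comment> \<open>The cap makes \<open>T' + 1\<close> consecutive times fit into \<open>W\<close>;
    \<open>B \<le> T'\<close> survives because \<open>B + 1 \<le> W\<close>.\<close>
  define T' where "T' = min T (W - 1)"
  obtain p where p: "prime p" "T' < p"
    using bigger_prime by blast
  interpret layered_code N B T' p
    by unfold_locales (use assms p in \<open>auto simp: T'_def\<close>)
  have "T' < W" "T' \<le> T"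
    using assms by (auto simp: T'_def)
  then obtain dec where "streaming_code (residue_field p) (m * T') (m * T' + B * (T' + 1)) encode dec T N B W"
    using streaming_code_encode by blast
  moreover have "m * T' < m * T' + B * (T' + 1)"
    using assms(2) by simp
  ultimately show ?thesis
    using rate_bound unfolding Let_def T'_def by blast
qed

end
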